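(* Let the two-phase problem (P9) with value function $v$ satisfy the long-horizon assumption (A-long) with the number $t_b$. Consider the bisection search: start with $t_{\rm low}=0$, $t_{\rm high}=t_b$; in each iteration set $t_{\rm mid}=(t_{\rm low}+t_{\rm high})/2$ and, if $v(t_{\rm mid})>m^*+t_f\,l(\rho_{\min})$, replace $t_{\rm high}$ by $t_{\rm mid}$, otherwise replace $t_{\rm low}$ by $t_{\rm mid}$. Then for any $\epsilon>0$ the bisection search finds, within finitely many iterations, a $t_s^*\in(0,t_b)$ (the current value of $t_{\rm high}$) such that $$m^*+t_f\,l(\rho_{\min})<v(t_s^* )<m^*+t_f\,l(\rho_{\min})+\frac{\epsilon}{2},$$ where $m^*$ is the optimal value of problem (P7). Moreover, problem (P9) generated by $t_s^*$ is normal.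
   Context: Data: $A_c\in\mathbb{R}^{n_x\times n_x}$, $B_c\in\mathbb{R}^{n_x\times n_u}$, $t_f>0$, $N\ge1$, $x_s\in\mathbb{R}^{n_x}$ (initial state), reals $\rho_{\min},\rho_{\max}$; convex $C^1$ functions $m:\mathbb{R}^{n_x}\to\mathbb{R}$, $g:\mathbb{R}^{n_u}\to\mathbb{R}$, $l:\mathbb{R}\to\mathbb{R}$, where the derivative of $l$ on the domain of $\sigma$ is bounded below by some $L_l>0$; $G:\mathbb{R}^{n_x}\to\mathbb{R}^{n_G}$ affine; a fixed $u_s\in\mathbb{R}^{n_u}$ with $g(u_s)=\rho_{\min}$. For a switching time $t_s$ put $x_{\rm init}(t_s)=\exp(A_ct_s)x_s+\int_0^{t_s}\exp(A_c\tau)d\tau\,B_cu_s$, $A(t_s)=\exp(A_c\frac{t_f-t_s}{N})$, $B(t_s)=\int_0^{(t_f-t_s)/N}\exp(A_c\tau)d\tau\,B_c$. Problem (P9) generated by $t_s$: minimize $m(x_{N+1})+\sum_{i=1}^N l(\sigma_i)\frac{t_f-t_s}{N}+t_s\,l(\rho_{\min})$ over $x=(x_1,\dots,x_{N+1})$, $u=(u_1,\dots,u_N)$, $\sigma=(\sigma_1,\dots,\sigma_N)$ subject to $x_{i+1}=A(t_s)x_i+B(t_s)u_i$, $\rho_{\min}\le\sigma_i\le\rho_{\max}$, $g(u_i)\le\sigma_i$ for $i=1,\dots,N$, $x_1=x_{\rm init}(t_s)$, $G(x_{N+1})=0$. Its optimal value is $v(t_s)$. With $z=(x,u,\sigma)$,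 let $F(z,t_s)=0$ collect its affine equality constraints and let $\tilde V=\{z:\rho_{\min}\le\sigma_i\le\rho_{\max},\ g(u_i)\le\sigma_i\ \forall i\}$. Problem (P7): minimize $m(x_{N+1})$ over $x_{N+1}\in\mathbb{R}^{n_x}$ subject to $G(x_{N+1})=0$; optimal value $m^*$. Problem (P4): minimize $m(x_{N+1})+\sum_{i=1}^N l_i(\sigma_i)$ subject to the constraints of (P9) with $t_s=0$, where $l_i:\mathbb{R}\to\mathbb{R}$ are the original convex $C^1$ stage costs, strictly increasing on $[\rho_{\min},\infty)$. A problem of this form is in the long-horizon case if, for its optimal solution, $\sigma_i^*=\rho_{\min}$ for all $i$ and $x_{N+1}^*$ solves (P7); otherwise it is normal (the same terminology applies to (P9)). Assumption (A-long): (P4) is in the long-horizon case; there exists $t_b$ with $v(t_b)>m^*+t_f\,l(\rho_{\min})$; and for every $t_s\in[0,t_b]$ problem (P9) satisfies: (a) the stage cost is $C^1$ and strictly increasing on $[\rho_{\min},\infty)$, $m$ is $C^1$, $\{u:g(u_i)\le\rho_{\min}\ \forall i\}$ is nonempty and $\{u:g(u_i)\le\rho_{\max}\ \forall i\}$ is compact; (b) $\operatorname{rank}(B(t_s),A(t_s)B(t_s),\dots,A(t_s)^{n_x-1}B(t_s))=n_x$; (c) $\nabla_zF(\cdot,t_s)$ (constant in $z$) has full row rank; (d) there is $z$ in the interior of $\tilde V$ with $F(z,t_s)=0$. *)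

theory Defs
  imports "HOL-Analysis.Analysis"
begin

section \<open>Analytic preliminaries\<close>

text \<open>\<open>exp\<close> is not available on \<open>real^'n^'n\<close> (whose class multiplication is componentwise).\<close>

definition mat_pow :: "real^'n^'n \<Rightarrow> nat \<Rightarrow> real^'n^'n" where
  "mat_pow A k = (((**) A) ^^ k) (mat 1)"

definition mat_exp :: "real^'n^'n \<Rightarrow> real^'n^'n" where
  "mat_exp A = (\<Sum>k. (1 / fact k) *\<^sub>R mat_pow A k)"

definition C1 :: "('a::real_normed_vector \<Rightarrow> 'b::real_normed_vector) \<Rightarrow> bool" where
  "C1 f \<longleftrightarrow> (\<exists>f'. (\<forall>x. (f has_derivative blinfun_apply (f' x)) (at x)) \<and> continuous_on UNIV f')"

definition affine_map :: "('a::real_vector \<Rightarrow> 'b::real_vector) \<Rightarrow> bool" where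
  "affine_map f \<longleftrightarrow> (\<exists>L c. linear L \<and> (\<forall>x. f x = L x + c))"


section \<open>Problem data\<close>

text \<open>
  The dimensions \<open>n_x\<close>, \<open>n_u\<close>, \<open>n_G\<close> are the cardinalities of the index types \<open>'n\<close>, \<open>'u\<close>, \<open>'g\<close>.
  The number of stages is \<open>N = CARD('h)\<close>, the elements of \<open>'h\<close> in increasing order being the
  stages \<open>1, \<dots>, N\<close>. The field \<open>l_orig\<close> holds the stage costs \<open>l_i\<close> of the one-phase problem.
\<close>

record ('n::finite, 'u::finite, 'g::finite, 'h::finite) two_phase =
  Ac :: "real^'n^'n"
  Bc :: "real^'u^'n"
  tf :: real
  x_s :: "real^'n"
  u_s :: "real^'u"
  rho_min :: real
  rho_max :: real
  m_cost :: "real^'n \<Rightarrow> real"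
  g_con :: "real^'u \<Rightarrow> real"
  l_cost :: "real \<Rightarrow> real"
  G_term :: "real^'n \<Rightarrow> real^'g"
  l_orig :: "'h \<Rightarrow> real \<Rightarrow> real"

definition standing :: "('n::finite, 'u::finite, 'g::finite, 'h::finite) two_phase \<Rightarrow> bool" where
  "standing P \<longleftrightarrow>
     0 < tf P \<and>
     convex_on UNIV (m_cost P) \<and> C1 (m_cost P) \<and>
     convex_on UNIV (g_con P) \<and> C1 (g_con P) \<and>
     convex_on UNIV (l_cost P) \<and> C1 (l_cost P) \<and>
     (\<exists>L>0. \<forall>s\<in>{rho_min P..rho_max P}. L \<le> deriv (l_cost P) s) \<and>
     affine_map (G_term P) \<and>
     g_con P (u_s P) = rho_min P \<and>
     (\<forall>i. convex_on UNIV (l_orig P i) \<and> C1 (l_orig P i) \<and>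
          strict_mono_on {rho_min P..} (l_orig P i))"


section \<open>Discretized dynamics\<close>

definition x_init :: "('n::finite, 'u::finite, 'g::finite, 'h::finite) two_phase \<Rightarrow> real \<Rightarrow> real^'n" where
  "x_init P t = mat_exp (t *\<^sub>R Ac P) *v x_s P
     + (integral {0..t} (\<lambda>\<tau>. mat_exp (\<tau> *\<^sub>R Ac P)) ** Bc P) *v u_s P"

definition step :: "('n::finite, 'u::finite, 'g::finite, 'h::finite) two_phase \<Rightarrow> real \<Rightarrow> real" where
  "step P t = (tf P - t) / real CARD('h)"

definition Ad :: "('n::finite, 'u::finite, 'g::finite, 'h::finite) two_phase \<Rightarrow> real \<Rightarrow> real^'n^'n" where
  "Ad P t = mat_exp (step P t *\<^sub>R Ac P)"

definition Bd :: "('n::finite, 'u::finite, 'g::finite, 'h::finite) two_phase \<Rightarrow> real \<Rightarrow> real^'u^'n" where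
  "Bd P t = integral {0..step P t} (\<lambda>\<tau>. mat_exp (\<tau> *\<^sub>R Ac P)) ** Bc P"


section \<open>The two-phase problem\<close>

text \<open>
  A point \<open>z = (x, u, \<sigma>)\<close>. The states \<open>x\<^sub>1, \<dots>, x\<^bsub>N+1\<^esub>\<close> are indexed by \<open>'h option\<close>:
  \<open>None\<close> stands for \<open>x\<^sub>1\<close> and \<open>Some i\<close> for \<open>x\<^bsub>i+1\<^esub>\<close>, the state reached after stage \<open>i\<close>.
\<close>

type_synonym ('n, 'u, 'h) point = "((real, 'n) vec, 'h option) vec \<times> ((real, 'u) vec, 'h) vec \<times> (real, 'h) vec"

type_synonym ('n, 'g, 'h) residual = "((real, 'n) vec, 'h) vec \<times> (real, 'n) vec \<times> (real, 'g) vec"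

definition state_before :: "(real^'n)^(('h::{finite,linorder}) option) \<Rightarrow> 'h \<Rightarrow> real^'n" where
  "state_before x i = (if \<exists>j. j < i then x $ Some (Max {j. j < i}) else x $ None)"

definition final_state :: "('n::finite, 'u::finite, 'h::{finite,linorder}) point \<Rightarrow> real^'n" where
  "final_state z = fst z $ Some (Max UNIV)"

definition sigma :: "('n::finite, 'u::finite, 'h::finite) point \<Rightarrow> real^'h" where
  "sigma z = snd (snd z)"

definition F_eq :: "('n::finite, 'u::finite, 'g::finite, 'h::{finite,linorder}) two_phase \<Rightarrow> real \<Rightarrow>
    ('n, 'u, 'h) point \<Rightarrow> ('n, 'g, 'h) residual" where
  "F_eq P t z = (case z of (x, u, s) \<Rightarrow>
     ((\<chi> i. x $ Some i - (Ad P t *v state_before x i + Bd P t *v (u $ i))),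
      x $ None - x_init P t,
      G_term P (final_state z)))"

definition V_set :: "('n::finite, 'u::finite, 'g::finite, 'h::finite) two_phase \<Rightarrow> ('n, 'u, 'h) point set" where
  "V_set P = {(x, u, s). \<forall>i. rho_min P \<le> s $ i \<and> s $ i \<le> rho_max P \<and> g_con P (u $ i) \<le> s $ i}"

definition feasible :: "('n::finite, 'u::finite, 'g::finite, 'h::{finite,linorder}) two_phase \<Rightarrow> real \<Rightarrow>
    ('n, 'u, 'h) point \<Rightarrow> bool" where
  "feasible P t z \<longleftrightarrow> F_eq P t z = 0 \<and> z \<in> V_set P"

definition stage_cost9 :: "('n::finite, 'u::finite, 'g::finite, 'h::finite) two_phase \<Rightarrow> real \<Rightarrow> real \<Rightarrow> real" where
  "stage_cost9 P t s = l_cost P s * step P t"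

definition objective9 :: "('n::finite, 'u::finite, 'g::finite, 'h::{finite,linorder}) two_phase \<Rightarrow> real \<Rightarrow>
    ('n, 'u, 'h) point \<Rightarrow> real" where
  "objective9 P t z = m_cost P (final_state z)
     + (\<Sum>i\<in>UNIV. stage_cost9 P t (sigma z $ i)) + t * l_cost P (rho_min P)"

text \<open>Optimal values are extended reals, so that an infeasible problem has value \<open>\<infinity>\<close>.\<close>

definition v :: "('n::finite, 'u::finite, 'g::finite, 'h::{finite,linorder}) two_phase \<Rightarrow> real \<Rightarrow> ereal" where
  "v P t = (INF z\<in>{z. feasible P t z}. ereal (objective9 P t z))"


section \<open>Terminal problem, one-phase problem, long-horizon and normal case\<close>

definition m_star :: "('n::finite, 'u::finite, 'g::finite, 'h::finite) two_phase \<Rightarrow> ereal" where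
  "m_star P = (INF x\<in>{x. G_term P x = 0}. ereal (m_cost P x))"

definition solves7 :: "('n::finite, 'u::finite, 'g::finite, 'h::finite) two_phase \<Rightarrow> real^'n \<Rightarrow> bool" where
  "solves7 P x \<longleftrightarrow> is_arg_min (m_cost P) (\<lambda>y. G_term P y = 0) x"

definition objective4 :: "('n::finite, 'u::finite, 'g::finite, 'h::{finite,linorder}) two_phase \<Rightarrow>
    ('n, 'u, 'h) point \<Rightarrow> real" where
  "objective4 P z = m_cost P (final_state z) + (\<Sum>i\<in>UNIV. l_orig P i (sigma z $ i))"

text \<open>
  Since the stage costs are strictly increasing, a solution with the property below exists iff
  solutions exist and all of them have it; hence it does not matter which solution is chosen.
  The distinction between the two cases presupposes that an optimal solution exists, so this
  is made part of both.
\<close>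

definition long_horizon :: "('n::finite, 'u::finite, 'g::finite, 'h::{finite,linorder}) two_phase \<Rightarrow>
    (('n, 'u, 'h) point \<Rightarrow> real) \<Rightarrow> real \<Rightarrow> bool" where
  "long_horizon P J t \<longleftrightarrow>
     (\<exists>z. is_arg_min J (feasible P t) z \<and> (\<forall>i. sigma z $ i = rho_min P) \<and> solves7 P (final_state z))"

definition normal :: "('n::finite, 'u::finite, 'g::finite, 'h::{finite,linorder}) two_phase \<Rightarrow>
    (('n, 'u, 'h) point \<Rightarrow> real) \<Rightarrow> real \<Rightarrow> bool" where
  "normal P J t \<longleftrightarrow> (\<exists>z. is_arg_min J (feasible P t) z) \<and> \<not> long_horizon P J t"


section \<open>The long-horizon assumption\<close>

definition cond_a :: "('n::finite, 'u::finite, 'g::finite, 'h::finite) two_phase \<Rightarrow> real \<Rightarrow> bool" where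
  "cond_a P t \<longleftrightarrow>
     C1 (stage_cost9 P t) \<and> strict_mono_on {rho_min P..} (stage_cost9 P t) \<and> C1 (m_cost P) \<and>
     {u :: (real^'u)^'h. \<forall>i. g_con P (u $ i) \<le> rho_min P} \<noteq> {} \<and>
     compact {u :: (real^'u)^'h. \<forall>i. g_con P (u $ i) \<le> rho_max P}"

text \<open>The rank of the block matrix \<open>(B, AB, \<dots>)\<close> is the dimension of the span of all its columns.\<close>

definition cond_b :: "('n::finite, 'u::finite, 'g::finite, 'h::finite) two_phase \<Rightarrow> real \<Rightarrow> bool" where
  "cond_b P t \<longleftrightarrow> dim (\<Union>k<CARD('n). columns (mat_pow (Ad P t) k ** Bd P t)) = CARD('n)"

text \<open>Full row rank: the rank of the derivative equals the number of scalar equations.\<close>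

definition cond_c :: "('n::finite, 'u::finite, 'g::finite, 'h::{finite,linorder}) two_phase \<Rightarrow> real \<Rightarrow> bool" where
  "cond_c P t \<longleftrightarrow>
     (\<forall>z. dim (range (frechet_derivative (F_eq P t) (at z))) = DIM(('n, 'g, 'h) residual))"

definition cond_d :: "('n::finite, 'u::finite, 'g::finite, 'h::{finite,linorder}) two_phase \<Rightarrow> real \<Rightarrow> bool" where
  "cond_d P t \<longleftrightarrow> (\<exists>z\<in>interior (V_set P). F_eq P t z = 0)"

definition threshold :: "('n::finite, 'u::finite, 'g::finite, 'h::finite) two_phase \<Rightarrow> ereal" where
  "threshold P = m_star P + ereal (tf P * l_cost P (rho_min P))"

text \<open>\<open>tb < tf P\<close> need not be required: \<open>cond_b\<close> fails at \<open>t = tf P\<close>, where \<open>Bd P t = 0\<close>.\<close>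

definition A_long :: "('n::finite, 'u::finite, 'g::finite, 'h::{finite,linorder}) two_phase \<Rightarrow> real \<Rightarrow> bool" where
  "A_long P tb \<longleftrightarrow>
     long_horizon P (objective4 P) 0 \<and>
     0 \<le> tb \<and> threshold P < v P tb \<and>
     (\<forall>t\<in>{0..tb}. cond_a P t \<and> cond_b P t \<and> cond_c P t \<and> cond_d P t)"


section \<open>Bisection search\<close>

text \<open>The pair of the current \<open>t_low\<close> and \<open>t_high\<close> after the given number of iterations.\<close>

primrec bisection :: "('n::finite, 'u::finite, 'g::finite, 'h::{finite,linorder}) two_phase \<Rightarrow> real \<Rightarrow>
    nat \<Rightarrow> real \<times> real" where
  "bisection P tb 0 = (0, tb)"
| "bisection P tb (Suc k) =
     (let (lo, hi) = bisection P tb k; mid = (lo + hi) / 2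
      in if threshold P < v P mid then (lo, mid) else (mid, hi))"

end

theory Submission
  imports Defs
begin

text \<open>
  The bisection maintains \<open>v t_low \<le> threshold < v t_high\<close>, so along a subsequence both ends tend
  to some \<open>t0\<close>, and minimizers for \<open>t_low\<close> accumulate, by compactness of the set of feasible pairs
  \<open>(t, z)\<close>, at a point feasible for \<open>t0\<close> with objective at most the threshold. Hence \<open>t0 < tb\<close>, and
  by the Slater and rank conditions nearby values of \<open>t_high\<close> admit feasible points with
  objective below \<open>threshold + \<epsilon> / 2\<close>. A long-horizon solution would have objective equal to
  the threshold, which is excluded by \<open>threshold < v t_high\<close>.
\<close>

section \<open>The matrix exponential\<close>

lemma bounded_bilinear_matrix_mult:
  "bounded_bilinear ((**) :: real^'a::finite^'b::finite \<Rightarrow> real^'c::finite^'a \<Rightarrow> real^'c^'b)"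
  unfolding bilinear_conv_bounded_bilinear[symmetric] bilinear_def
  by (auto intro!: linearI simp: matrix_add_ldistrib matrix_matrix_mult_def vec_eq_iff
        sum.distrib algebra_simps sum_distrib_left)

lemma bounded_bilinear_matrix_vector_mult:
  "bounded_bilinear ((*v) :: real^'a::finite^'b::finite \<Rightarrow> real^'a \<Rightarrow> real^'b)"
  unfolding bilinear_conv_bounded_bilinear[symmetric] bilinear_def
  by (auto intro!: linearI simp: matrix_vector_mult_def vec_eq_iff
        sum.distrib algebra_simps sum_distrib_left)

lemmas continuous_on_matrix_mult [continuous_intros] =
  bounded_bilinear.continuous_on[OF bounded_bilinear_matrix_mult]

lemmas continuous_on_matrix_vector_product [continuous_intros] =
  bounded_bilinear.continuous_on[OF bounded_bilinear_matrix_vector_mult]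

lemma mat_pow_0: "mat_pow A 0 = mat 1"
  and mat_pow_Suc: "mat_pow A (Suc k) = A ** mat_pow A k"
  by (simp_all add: mat_pow_def)

lemma mat_pow_scaleR: "mat_pow (c *\<^sub>R A) k = c ^ k *\<^sub>R mat_pow A k"
proof (induction k)
  case (Suc k)
  interpret bounded_bilinear "(**) :: real^'a^'a \<Rightarrow> real^'a^'a \<Rightarrow> _"
    by (rule bounded_bilinear_matrix_mult)
  show ?case
    by (simp add: mat_pow_Suc Suc scaleR_left scaleR_right)
qed (simp add: mat_pow_0)

text \<open>Bilinearity bounds the norm of a product up to some constant \<open>C\<close>, and
  \<open>K = norm A * C\<close> absorbs it. The induction starts from \<open>mat 1\<close>, whose
  norm need not be 1, hence the extra factor.\<close>

lemma norm_mat_pow_le: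
  fixes A :: "real^'a::finite^'a"
  obtains K where "K \<ge> 0" "\<And>k. norm (mat_pow A k) \<le> norm (mat 1 :: real^'a^'a) * K ^ k"
proof -
  interpret bounded_bilinear "(**) :: real^'a^'a \<Rightarrow> real^'a^'a \<Rightarrow> _"
    by (rule bounded_bilinear_matrix_mult)
  obtain C where C: "C \<ge> 0" "\<And>(X :: real^'a^'a) (Y :: real^'a^'a). norm (X ** Y) \<le> norm X * norm Y * C"
    using nonneg_bounded by blast
  have "norm (mat_pow A k) \<le> norm (mat 1 :: real^'a^'a) * (norm A * C) ^ k" for k
  proof (induction k)
    case (Suc k)
    have "norm (mat_pow A (Suc k)) \<le> (norm A * C) * norm (mat_pow A k)"
      using C(2)[of A "mat_pow A k"] by (simp add: mat_pow_Suc mult_ac)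
    also have "\<dots> \<le> (norm A * C) * (norm (mat 1 :: real^'a^'a) * (norm A * C) ^ k)"
      using Suc C(1) by (intro mult_left_mono) auto
    finally show ?case by (simp add: mult_ac)
  qed (simp add: mat_pow_0)
  with C(1) that show thesis by (metis mult_nonneg_nonneg norm_ge_zero)
qed

text \<open>On a bounded set with |t| \<le> r the series is dominated by a constant times the real
  exponential series at \<open>r * K\<close>. So the continuous partial sums converge
  uniformly.\<close>

lemma continuous_on_mat_exp_scaleR:
  fixes A :: "real^'a::finite^'a"
  assumes "bounded T"
  shows "continuous_on T (\<lambda>t. mat_exp (t *\<^sub>R A))"
proof -
  obtain r where r: "\<And>t. t \<in> T \<Longrightarrow> \<bar>t\<bar> \<le> r"
    using assms by (auto simp: bounded_iff)
  obtain K where K: "K \<ge> 0" "\<And>k. norm (mat_pow A k) \<le> norm (mat 1 :: real^'a^'a) * K ^ k"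
    using norm_mat_pow_le[of A] by metis
  have bound: "norm ((1 / fact k) *\<^sub>R mat_pow (t *\<^sub>R A) k)
      \<le> norm (mat 1 :: real^'a^'a) * (inverse (fact k) * (r * K) ^ k)" if "t \<in> T" for t k
  proof -
    have "\<bar>t\<bar> ^ k * norm (mat_pow A k) \<le> r ^ k * (norm (mat 1 :: real^'a^'a) * K ^ k)"
      using r[OF that] K by (intro mult_mono power_mono) auto
    then have "inverse (fact k) * (\<bar>t\<bar> ^ k * norm (mat_pow A k))
        \<le> inverse (fact k) * (r ^ k * (norm (mat 1 :: real^'a^'a) * K ^ k))"
      by (intro mult_left_mono) auto
    then show ?thesis
      by (simp add: mat_pow_scaleR power_abs power_mult_distrib field_simps)
  qed
  have "summable (\<lambda>k. norm (mat 1 :: real^'a^'a) * (inverse (fact k) * (r * K) ^ k))"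
    by (intro summable_mult summable_exp)
  from Weierstrass_m_test[OF bound this]
  have "uniform_limit T (\<lambda>n t. \<Sum>k<n. (1 / fact k) *\<^sub>R mat_pow (t *\<^sub>R A) k)
      (\<lambda>t. mat_exp (t *\<^sub>R A)) sequentially"
    by (simp add: mat_exp_def)
  then show ?thesis
    by (rule uniform_limit_theorem[rotated])
       (auto simp: mat_pow_scaleR intro!: always_eventually continuous_intros)
qed

section \<open>Perturbation of equality constraints\<close>

text \<open>
  Moving towards the Slater point makes the inequality constraints inactive. A right inverse
  \<open>R\<close> of the linear part of \<open>F t0\<close> then turns the equation at a nearby parameter \<open>t\<close> into the
  fixed point problem \<open>y = y - F t (w + R y)\<close> in a small ball, solved by Brouwer.
\<close>

lemma slater_perturbation:
  fixes F :: "real \<Rightarrow> 'z::euclidean_space \<Rightarrow> 'y::euclidean_space" and J :: "real \<Rightarrow> 'z \<Rightarrow> real"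
  assumes "compact T" and t0: "t0 \<in> T"
    and contF: "continuous_on (T \<times> UNIV) (\<lambda>(t, z). F t z)"
    and contJ: "continuous_on (T \<times> UNIV) (\<lambda>(t, z). J t z)"
    and "linear L" "surj L" and FL: "\<And>z. F t0 z = L z + c"
    and "convex V" and z0: "z0 \<in> interior V" "F t0 z0 = 0"
    and z1: "z1 \<in> V" "F t0 z1 = 0"
    and less: "J t0 z1 < \<gamma>"
  shows "\<exists>d>0. \<forall>t\<in>T. dist t t0 < d \<longrightarrow> (\<exists>z\<in>V. F t z = 0 \<and> J t z < \<gamma>)"
proof -
  have contJ0: "continuous_on UNIV (J t0)"
    using continuous_on_compose2[OF contJ, of UNIV "\<lambda>z. (t0, z)"] t0
    by (auto simp: continuous_on_Pair)
  \<comment> \<open>The level \<beta> splits the slack in the objective: the move within the problem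
    at \<open>t0\<close> stays below \<beta>, and \<gamma> - \<beta> is left for the change from
    \<open>t0\<close> to \<open>t\<close>.\<close>
  define \<beta> where "\<beta> = (J t0 z1 + \<gamma>) / 2"
  have \<beta>: "J t0 z1 < \<beta>" "\<beta> < \<gamma>" using less by (auto simp: \<beta>_def)
  define W where "W = interior V \<inter> {z. J t0 z < \<beta>}"
  have "open {z. J t0 z < \<beta>}"
    using contJ0 by (intro open_Collect_less continuous_intros) auto
  then have "open W" by (auto simp: W_def)
  \<comment> \<open>The segment from \<open>z1\<close> towards the Slater point \<open>z0\<close>.
    By convexity \<open>w s\<close> is interior to \<open>V\<close> for 0 < s < 1, and by continuity
    small s keeps the objective below \<beta>.\<close>
  define w where "w s = z1 - s *\<^sub>R (z1 - z0)" for s :: real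
  have "((\<lambda>s. J t0 (w s)) \<longlongrightarrow> J t0 (w 0)) (at_right 0)"
  proof -
    have "continuous_on UNIV (\<lambda>s. J t0 (w s))"
      unfolding w_def by (intro continuous_on_compose2[OF contJ0] continuous_intros) auto
    then show ?thesis
      by (metis continuous_on_def UNIV_I tendsto_within_subset subset_UNIV)
  qed
  then have "eventually (\<lambda>s. J t0 (w s) < \<beta>) (at_right 0)"
    using \<beta>(1) by (intro order_tendstoD) (auto simp: w_def)
  moreover have "eventually (\<lambda>s::real. s \<in> {0<..<1}) (at_right 0)"
    by (rule eventually_at_right_real) simp
  ultimately have "eventually (\<lambda>s. J t0 (w s) < \<beta> \<and> s \<in> {0<..<1}) (at_right (0::real))"
    by (rule eventually_conj)
  then obtain s where s: "J t0 (w s) < \<beta>" "0 < s" "s < 1"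
    using eventually_happens'[OF trivial_limit_at_right_real] by fastforce
  have "w s \<in> W"
    using mem_interior_convex_shrink[OF \<open>convex V\<close> z0(1) z1(1), of s] s by (auto simp: W_def w_def)
  obtain R where R: "linear R" "\<And>y. L (R y) = y"
    using linear_surjective_right_inverse[OF \<open>linear L\<close> \<open>surj L\<close>] by (metis comp_apply id_apply)
  have contR: "continuous_on X R" for X
    using R(1) by (simp add: linear_continuous_on linear_conv_bounded_linear)
  \<comment> \<open>As an affine combination of two solutions, \<open>w s\<close> solves the
    equation at \<open>t0\<close>. Along the directions supplied by \<open>R\<close> the residual at
    \<open>t0\<close> is therefore the identity.\<close>
  have FR: "F t0 (w s + R y) = y" for y
  proof -
    have "L z1 = - c" "L z0 = - c"
      using z0(2) z1(2) unfolding FL eq_neg_iff_add_eq_0 by blast+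
    then show ?thesis
      by (simp add: FL w_def linear_add[OF \<open>linear L\<close>] linear_diff[OF \<open>linear L\<close>]
          linear_scale[OF \<open>linear L\<close>] R(2))
  qed
  have "open ((\<lambda>y. w s + R y) -` W)"
    using \<open>open W\<close> by (intro open_vimage continuous_intros contR)
  moreover have "0 \<in> (\<lambda>y. w s + R y) -` W"
    using \<open>w s \<in> W\<close> linear_0[OF R(1)] by simp
  ultimately obtain \<delta> where \<delta>: "\<delta> > 0" "cball 0 \<delta> \<subseteq> (\<lambda>y. w s + R y) -` W"
    by (meson open_contains_cball)
  let ?C = "T \<times> cball (0::'y) \<delta>"
  let ?f = "\<lambda>p. F (fst p) (w s + R (snd p))" and ?j = "\<lambda>p. J (fst p) (w s + R (snd p))"
  have cont1: "continuous_on ?C (\<lambda>p. (fst p, w s + R (snd p)))"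
    by (intro continuous_intros continuous_on_compose2[OF contR]) auto
  have contf: "continuous_on ?C ?f"
    using continuous_on_compose2[OF contF cont1] by force
  have contj: "continuous_on ?C ?j"
    using continuous_on_compose2[OF contJ cont1] by force
  have "compact ?C" using \<open>compact T\<close> by (intro compact_Times) auto
  \<comment> \<open>Uniform continuity on the compact product gives one \<open>d1\<close> that
    serves every y in the ball; Brouwer needs such a uniform estimate.\<close>
  obtain d1 where d1: "d1 > 0"
    "\<And>p q. p \<in> ?C \<Longrightarrow> q \<in> ?C \<Longrightarrow> dist q p < d1 \<Longrightarrow> dist (?f q) (?f p) < \<delta>"
    using compact_uniformly_continuous[OF contf \<open>compact ?C\<close>] \<delta>(1)
    unfolding uniformly_continuous_on_def by metis
  obtain d2 where d2: "d2 > 0"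
    "\<And>p q. p \<in> ?C \<Longrightarrow> q \<in> ?C \<Longrightarrow> dist q p < d2 \<Longrightarrow> dist (?j q) (?j p) < \<gamma> - \<beta>"
    using compact_uniformly_continuous[OF contj \<open>compact ?C\<close>] \<beta>(2)
    unfolding uniformly_continuous_on_def by (metis diff_gt_0_iff_gt)
  have "\<exists>z\<in>V. F t z = 0 \<and> J t z < \<gamma>" if t: "t \<in> T" "dist t t0 < min d1 d2" for t
  proof -
    have close: "dist (t, y) (t0, y) < min d1 d2" for y :: 'y
      using t(2) by (simp add: dist_Pair_Pair)
    have contg: "continuous_on (cball 0 \<delta>) (\<lambda>y. y - F t (w s + R y))"
      using continuous_on_compose2[OF contf, of "cball 0 \<delta>" "\<lambda>y. (t, y)"] t(1)
      by (auto simp: continuous_on_Pair intro!: continuous_on_diff)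
    \<comment> \<open>By \<open>FR\<close> the image of y is the difference of the residuals at
      \<open>t0\<close> and \<open>t\<close>, so its norm is below \<delta>. A fixed point is a zero
      of the residual at \<open>t\<close>.\<close>
    have "(\<lambda>y. y - F t (w s + R y)) \<in> cball 0 \<delta> \<rightarrow> cball 0 \<delta>"
    proof
      fix y :: 'y assume y: "y \<in> cball 0 \<delta>"
      then have "dist (F t (w s + R y)) (F t0 (w s + R y)) < \<delta>"
        using d1(2)[of "(t0, y)" "(t, y)"] close[of y] t(1) t0 by simp
      then show "y - F t (w s + R y) \<in> cball 0 \<delta>"
        by (simp add: FR dist_norm norm_minus_commute)
    qed
    from brouwer_ball[OF \<delta>(1) contg this]
    obtain y where y: "y \<in> cball 0 \<delta>" "F t (w s + R y) = 0"
      by (auto simp: algebra_simps)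
    have "w s + R y \<in> W" using \<delta>(2) y(1) by auto
    moreover have "dist (J t (w s + R y)) (J t0 (w s + R y)) < \<gamma> - \<beta>"
      using d2(2)[of "(t0, y)" "(t, y)"] close[of y] t(1) t0 y(1) by simp
    ultimately have "w s + R y \<in> V" "J t (w s + R y) < \<gamma>"
      using interior_subset[of V] by (auto simp: W_def dist_real_def)
    then show ?thesis using y(2) by blast
  qed
  then show ?thesis using d1(1) d2(1) by (intro exI[of _ "min d1 d2"]) simp
qed

section \<open>Compactness and continuity of the two-phase problem\<close>

lemma linear_state_before: "linear (\<lambda>x. state_before x i)"
  by (cases "\<exists>j. j < i") (auto intro!: linearI simp: state_before_def)

lemma continuous_on_state_before [continuous_intros]:
  "continuous_on X f \<Longrightarrow> continuous_on X (\<lambda>t. state_before (f t) i)"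
  by (rule continuous_on_compose2[of UNIV "\<lambda>x. state_before x i"])
     (auto simp: linear_state_before linear_continuous_on linear_conv_bounded_linear[symmetric])

lemma C1_continuous_on: "C1 f \<Longrightarrow> continuous_on X f"
  unfolding C1_def
  by (meson continuous_at_imp_continuous_on has_derivative_continuous)

lemma affine_map_F_eq:
  fixes P :: "('n::finite, 'u::finite, 'g::finite, 'h::{finite,linorder}) two_phase"
  assumes "affine_map (G_term P)"
  shows "affine_map (F_eq P t)"
proof -
  obtain L c where "linear L" and G: "\<And>x. G_term P x = L x + c"
    using assms by (auto simp: affine_map_def)
  \<comment> \<open>The linear part: only \<open>x_init\<close> and the constant term of
    \<open>G_term\<close> are split off.\<close>
  define M where "M z = ((\<chi> i. fst z $ Some i - (Ad P t *v state_before (fst z) i + Bd P t *v (fst (snd z) $ i))),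
      fst z $ None, L (final_state z))" for z :: "('n, 'u, 'h) point"
  have "linear M"
    by (rule linearI)
       (auto simp: M_def vec_eq_iff final_state_def linear_add[OF \<open>linear L\<close>]
          linear_scale[OF \<open>linear L\<close>] linear_add[OF linear_state_before]
          linear_scale[OF linear_state_before] matrix_vector_right_distrib
          matrix_vector_mult_scaleR algebra_simps)
  moreover have "F_eq P t z = M z + (0, - x_init P t, c)" for z
    by (auto simp: F_eq_def M_def G final_state_def vec_eq_iff split: prod.splits)
  ultimately show ?thesis unfolding affine_map_def by blast
qed

text \<open>The derivative of an affine map is its linear part, so the full rank in
  \<open>cond_c\<close> says that the range of this part has full dimension.\<close>

lemma F_eq_surjective_part:
  fixes P :: "('n::finite, 'u::finite, 'g::finite, 'h::{finite,linorder}) two_phase"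
  assumes "affine_map (G_term P)" and "cond_c P t"
  obtains L c where "linear L" "surj L" "\<forall>z. F_eq P t z = L z + c"
proof -
  obtain L c where L: "linear L" "\<And>z. F_eq P t z = L z + c"
    using affine_map_F_eq[OF assms(1)] by (metis affine_map_def)
  have "F_eq P t = (\<lambda>z. L z + c)" using L(2) by blast
  moreover have "((\<lambda>z. L z + c) has_derivative L) (at 0)"
    using L(1) by (intro has_derivative_add_const bounded_linear_imp_has_derivative)
       (simp add: linear_conv_bounded_linear)
  ultimately have "(F_eq P t has_derivative L) (at 0)" by simp
  then have "frechet_derivative (F_eq P t) (at 0) = L"
    by (rule frechet_derivative_at[symmetric])
  then have "dim (range L) = DIM(('n, 'g, 'h) residual)"
    using assms(2)[unfolded cond_c_def, THEN spec, of 0] by simp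
  then have "span (range L) = UNIV" by (simp only: dim_eq_full)
  then have "surj L"
    using linear_subspace_image[OF L(1) subspace_UNIV] by (metis span_eq_iff)
  with L that show thesis by blast
qed


section \<open>Continuity in the switching time\<close>

lemma step_bounds:
  fixes P :: "('n::finite, 'u::finite, 'g::finite, 'h::finite) two_phase"
  assumes "t \<in> {0..b}" "b < tf P"
  shows "step P t \<in> {0..tf P / real CARD('h)}"
  using assms by (auto simp: step_def divide_right_mono)

lemma continuous_on_step [continuous_intros]: "continuous_on X (step P)"
  unfolding step_def by (intro continuous_intros) auto

lemma continuous_on_integral_mat_exp:
  "continuous_on {0..c} (\<lambda>t. integral {0..t} (\<lambda>\<tau>. mat_exp (\<tau> *\<^sub>R A)))"
  by (intro indefinite_integral_continuous_1 integrable_continuous_real continuous_on_mat_exp_scaleR) auto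

text \<open>For \<open>b < tf P\<close> the step stays in the fixed interval from 0 to
  \<open>tf P / N\<close>, where N is the number of stages. The exponential is continuous there, and
  so, for \<open>Bd\<close>, is its integral as a function of the upper end.\<close>

lemma continuous_on_Ad:
  fixes P :: "('a::finite, 'b::finite, 'c::finite, 'd::finite) two_phase"
  assumes "b < tf P"
  shows "continuous_on {0..b} (Ad P)"
  unfolding Ad_def
  by (rule continuous_on_compose2[OF continuous_on_mat_exp_scaleR[OF
        bounded_closed_interval[of 0 "tf P / real CARD('d)"]] continuous_on_step])
     (use step_bounds[OF _ assms] in auto)

lemma continuous_on_Bd:
  fixes P :: "('a::finite, 'b::finite, 'c::finite, 'd::finite) two_phase"
  assumes "b < tf P"
  shows "continuous_on {0..b} (Bd P)"
  unfolding Bd_def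
  by (intro continuous_intros continuous_on_compose2[OF
        continuous_on_integral_mat_exp[of "tf P / real CARD('d)"] continuous_on_step])
     (use step_bounds[OF _ assms] in auto)

lemma continuous_on_x_init: "continuous_on {0..b} (x_init P)"
  unfolding x_init_def
  by (intro continuous_intros continuous_on_integral_mat_exp continuous_on_mat_exp_scaleR) auto

lemma affine_map_continuous_on:
  fixes f :: "'a::euclidean_space \<Rightarrow> 'b::real_normed_vector"
  assumes "affine_map f"
  shows "continuous_on X f"
  using assms unfolding affine_map_def
  by (metis (no_types, lifting) continuous_on_add continuous_on_const continuous_on_cong
      linear_continuous_on linear_conv_bounded_linear)

lemma continuous_on_F_eq:
  fixes P :: "('n::finite, 'u::finite, 'g::finite, 'h::{finite,linorder}) two_phase"
  assumes "affine_map (G_term P)" "b < tf P"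
  shows "continuous_on ({0..b} \<times> UNIV) (\<lambda>(t, z). F_eq P t z)"
proof -
  have fst: "continuous_on ({0..b} \<times> UNIV) (\<lambda>p. f (fst p))" if "continuous_on {0..b} f"
    for f :: "real \<Rightarrow> 'c::topological_space"
    by (rule continuous_on_compose2[OF that]) (auto intro!: continuous_intros)
  have G: "continuous_on UNIV (G_term P)"
    by (rule affine_map_continuous_on[OF assms(1)])
  have "continuous_on ({0..b} \<times> UNIV)
     (\<lambda>p. ((\<chi> i. fst (snd p) $ Some i - (Ad P (fst p) *v state_before (fst (snd p)) i + Bd P (fst p) *v (fst (snd (snd p)) $ i))),
      fst (snd p) $ None - x_init P (fst p),
      G_term P (fst (snd p) $ Some (Max UNIV))) :: ('n, 'g, 'h) residual)"
    by (intro continuous_intros continuous_on_vec_lambda fst continuous_on_Ad continuous_on_Bd continuous_on_x_init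
        continuous_on_compose2[OF G] assms) auto
  then show ?thesis
    by (simp add: F_eq_def final_state_def split_def)
qed

lemma continuous_on_objective9:
  assumes "continuous_on UNIV (m_cost P)" "continuous_on UNIV (l_cost P)"
  shows "continuous_on X (\<lambda>(t, z). objective9 P t z)"
  unfolding objective9_def stage_cost9_def final_state_def sigma_def step_def split_def
  by (intro continuous_intros continuous_on_compose2[OF assms(1)] continuous_on_compose2[OF assms(2)]) auto

section \<open>The inequality constraints and compactness of the feasible graph\<close>

lemma V_set_eq:
  "V_set P = (\<Inter>i. {z. rho_min P \<le> snd (snd z) $ i} \<inter> {z. snd (snd z) $ i \<le> rho_max P}
     \<inter> {z. g_con P (fst (snd z) $ i) \<le> snd (snd z) $ i})"
  by (auto simp: V_set_def)

lemma closed_V_set: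
  assumes "continuous_on UNIV (g_con P)"
  shows "closed (V_set P)"
  unfolding V_set_eq
  by (intro closed_INT ballI closed_Int closed_Collect_le continuous_intros
        continuous_on_compose2[OF assms]) auto

lemma convex_V_set:
  assumes "convex_on UNIV (g_con P)"
  shows "convex (V_set P)"
proof (rule convexI)
  fix z z' a b
  assume z: "z \<in> V_set P" "z' \<in> V_set P" and ab: "0 \<le> (a::real)" "0 \<le> b" "a + b = 1"
  have "g_con P (a *\<^sub>R fst (snd z) $ i + b *\<^sub>R fst (snd z') $ i)
      \<le> a * snd (snd z) $ i + b * snd (snd z') $ i" for i
  proof -
    have "g_con P (a *\<^sub>R fst (snd z) $ i + b *\<^sub>R fst (snd z') $ i)
        \<le> a * g_con P (fst (snd z) $ i) + b * g_con P (fst (snd z') $ i)"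
      using assms ab by (auto simp: convex_on_def)
    also have "\<dots> \<le> a * snd (snd z) $ i + b * snd (snd z') $ i"
      using z ab by (intro add_mono mult_left_mono) (auto simp: V_set_eq)
    finally show ?thesis .
  qed
  moreover have "a * snd (snd z) $ i + b * snd (snd z') $ i \<in> {rho_min P..rho_max P}" for i
    using convexD[OF convex_real_interval(5), of "snd (snd z) $ i" "rho_min P" "rho_max P" "snd (snd z') $ i" a b]
      z ab by (auto simp: V_set_eq)
  ultimately show "a *\<^sub>R z + b *\<^sub>R z' \<in> V_set P"
    by (auto simp: V_set_eq)
qed

text \<open>Boundedness passes from stage to stage: if the previous states are bounded uniformly in
  t, then the next ones lie in the continuous image of a compact set of triples (t, state,
  control).\<close>

lemma bounded_states:
  fixes P :: "('n::finite, 'u::finite, 'g::finite, 'h::{finite,linorder}) two_phase"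
  assumes "b < tf P" and "compact {u :: (real^'u)^'h::{finite,linorder}. \<forall>i. g_con P (u $ i) \<le> rho_max P}"
  shows "bounded {fst z $ j |t z. t \<in> {0..b} \<and> feasible P t z}"
proof -
  let ?B = "\<lambda>j. bounded {fst z $ j |t z. t \<in> {0..b} \<and> feasible P t z}"
  have "bounded (x_init P ` {0..b})"
    by (intro compact_imp_bounded compact_continuous_image continuous_on_x_init) auto
  then have None: "?B None"
    by (rule bounded_subset) (auto simp: feasible_def F_eq_def zero_prod_def)
  have Some: "?B (Some i)" for i
  \<comment> \<open>The number of earlier stages serves as the stage number.\<close>
  proof (induction "card {j. j < i}" arbitrary: i rule: less_induct)
    case less
    \<comment> \<open>This index is the one that \<open>state_before\<close> selects:
      \<open>None\<close> at the first stage, otherwise the immediate predecessor, which has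
      strictly fewer earlier stages.\<close>
    have "?B (if \<exists>j. j < i then Some (Max {j. j < i}) else None)"
    proof (cases "\<exists>j. j < i")
      case True
      then have "Max {j. j < i} < i"
        using Max_in[of "{j. j < i}"] by auto
      then have "card {j. j < Max {j. j < i}} < card {j. j < i}"
        by (intro psubset_card_mono) (auto dest: order.strict_trans)
      with less True show ?thesis by auto
    qed (use None in auto)
    then obtain M where "\<And>t z. t \<in> {0..b} \<Longrightarrow> feasible P t z \<Longrightarrow>
        norm (fst z $ (if \<exists>j. j < i then Some (Max {j. j < i}) else None)) \<le> M"
      unfolding bounded_iff by blast
    then have M: "norm (state_before (fst z) i) \<le> M" if "t \<in> {0..b}" "feasible P t z" for t z
      using \<open>\<And>t z. \<lbrakk>t \<in> {0..b}; feasible P t z\<rbrakk> \<Longrightarrow> _\<close>[OF that]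
      by (cases "\<exists>j. j < i") (simp_all add: state_before_def)
    obtain U where U: "\<And>u :: (real^'u)^'h::{finite,linorder}. (\<And>i. g_con P (u $ i) \<le> rho_max P) \<Longrightarrow> norm u \<le> U"
      using compact_imp_bounded[OF assms(2)] by (auto simp: bounded_iff)
    let ?K = "{0..b} \<times> cball (0 :: real^'n) M \<times> cball (0 :: real^'u) U"
    let ?f = "\<lambda>p. Ad P (fst p) *v fst (snd p) + Bd P (fst p) *v snd (snd p)"
    have "continuous_on ?K ?f"
      by (intro continuous_intros continuous_on_compose2[OF continuous_on_Ad[OF assms(1)]]
          continuous_on_compose2[OF continuous_on_Bd[OF assms(1)]]) auto
    then have "bounded (?f ` ?K)"
      by (intro compact_imp_bounded compact_continuous_image compact_Times) auto
    moreover have "fst z $ Some i \<in> ?f ` ?K" if t: "t \<in> {0..b}" and z: "feasible P t z" for t z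
    proof (rule image_eqI[of _ _ "(t, state_before (fst z) i, fst (snd z) $ i)"])
      show "fst z $ Some i = ?f (t, state_before (fst z) i, fst (snd z) $ i)"
        using z by (auto simp: feasible_def F_eq_def zero_prod_def vec_eq_iff split: prod.splits)
      have "g_con P (fst (snd z) $ j) \<le> rho_max P" for j
        using z order_trans by (fastforce simp: feasible_def V_set_eq)
      from U[OF this] have "norm (fst (snd z) $ i) \<le> U"
        using Finite_Cartesian_Product.norm_nth_le order_trans by blast
      with t M[OF t z] show "(t, state_before (fst z) i, fst (snd z) $ i) \<in> ?K" by auto
    qed
    ultimately show ?case by (elim bounded_subset) blast
  qed
  show ?thesis by (cases j) (use None Some in auto)
qed

lemma bounded_vec:
  fixes X :: "('a::real_normed_vector ^ 'i::finite) set"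
  assumes "\<And>i. bounded ((\<lambda>x. x $ i) ` X)"
  shows "bounded X"
proof -
  have "\<forall>i. \<exists>M. \<forall>x\<in>X. norm (x $ i) \<le> M"
    using assms by (simp add: bounded_iff)
  from choice[OF this] obtain M where M: "\<forall>i. \<forall>x\<in>X. norm (x $ i) \<le> M i" ..
  have "norm x \<le> sum M UNIV" if "x \<in> X" for x
  proof -
    have "norm x \<le> (\<Sum>i\<in>UNIV. norm (x $ i))"
      unfolding norm_vec_def by (rule L2_set_le_sum) auto
    also have "\<dots> \<le> sum M UNIV" using M that by (intro sum_mono) auto
    finally show ?thesis .
  qed
  then show ?thesis by (auto simp: bounded_iff)
qed

text \<open>Keeping t as a coordinate makes limits of points feasible for different switching times
  available. Closedness comes from the joint continuity of the residual, boundedness from that of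
  the states, the controls and \<sigma> separately.\<close>

lemma compact_feasible_graph:
  fixes P :: "('n::finite, 'u::finite, 'g::finite, 'h::{finite,linorder}) two_phase"
  assumes G: "affine_map (G_term P)" and g: "continuous_on UNIV (g_con P)" and b: "b < tf P"
    and U: "compact {u :: (real^'u)^'h::{finite,linorder}. \<forall>i. g_con P (u $ i) \<le> rho_max P}"
  shows "compact {(t, z). t \<in> {0..b} \<and> feasible P t z}" (is "compact ?S")
proof -
  have "closed (({0..b} \<times> UNIV) \<inter> (\<lambda>(t, z). F_eq P t z) -` {0})"
    by (intro continuous_closed_preimage continuous_on_F_eq G b closed_Times) auto
  moreover have "closed (UNIV \<times> V_set P)"
    by (intro closed_Times closed_V_set g closed_UNIV)
  ultimately have "closed ((({0..b} \<times> UNIV) \<inter> (\<lambda>(t, z). F_eq P t z) -` {0}) \<inter> (UNIV \<times> V_set P))"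
    by (rule closed_Int)
  also have "\<dots> = ?S" by (auto simp: feasible_def)
  finally have "closed ?S" .
  let ?Z = "snd ` ?S"
  have "bounded (fst ` ?Z)"
    by (rule bounded_vec, rule bounded_subset[OF bounded_states[OF b U]]) force
  moreover have "bounded (fst ` snd ` ?Z)"
    by (rule bounded_subset[OF compact_imp_bounded[OF U]])
       (use order_trans in \<open>fastforce simp: feasible_def V_set_def\<close>)
  moreover have "bounded (snd ` snd ` ?Z)"
    by (rule bounded_subset[OF bounded_cbox[of "\<chi> i. rho_min P" "\<chi> i. rho_max P"]])
       (force simp: feasible_def V_set_def mem_box_cart)
  ultimately have "bounded ({0..b} \<times> fst ` ?Z \<times> fst ` snd ` ?Z \<times> snd ` snd ` ?Z)"
    by (intro bounded_Times) auto
  moreover have "?S \<subseteq> {0..b} \<times> fst ` ?Z \<times> fst ` snd ` ?Z \<times> snd ` snd ` ?Z"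
  proof
    fix p assume p: "p \<in> ?S"
    then have "snd p \<in> ?Z" by (rule imageI)
    from imageI[OF this, of fst] imageI[OF imageI[OF this, of snd], of fst]
      imageI[OF imageI[OF this, of snd], of snd] p
    show "p \<in> {0..b} \<times> fst ` ?Z \<times> fst ` snd ` ?Z \<times> snd ` snd ` ?Z"
      unfolding mem_Times_iff by (intro conjI) auto
  qed
  ultimately have "bounded ?S" by (rule bounded_subset)
  with \<open>closed ?S\<close> show ?thesis by (simp add: compact_eq_bounded_closed)
qed

section \<open>The bisection search\<close>

text \<open>Since the order on \<open>ereal\<close> is total, the branch test puts the midpoint on
  the side of the end that it replaces. Each iteration halves the length.\<close>

lemma bisection_invariant:
  assumes "v P 0 \<le> threshold P" "threshold P < v P tb" "0 \<le> tb" "bisection P tb k = (lo, hi)"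
  shows "0 \<le> lo" "lo \<le> hi" "hi \<le> tb" "hi - lo = tb / 2 ^ k"
    "v P lo \<le> threshold P" "threshold P < v P hi"
  using assms(4)
proof (induction k arbitrary: lo hi)
  case 0
  {
    case 1 with assms show ?case by auto
  next
    case 2 with assms show ?case by auto
  next
    case 3 with assms show ?case by auto
  next
    case 4 with assms show ?case by auto
  next
    case 5 with assms show ?case by auto
  next
    case 6 with assms show ?case by auto
  }
next
  case (Suc k)
  obtain l h where lh: "bisection P tb k = (l, h)" by fastforce
  note IH = Suc[OF lh]
  {
    case 1 with IH lh show ?case by (auto simp: Let_def split: if_splits)
  next
    case 2 with IH lh show ?case by (auto simp: Let_def split: if_splits)
  next
    case 3 with IH lh show ?case by (auto simp: Let_def split: if_splits)
  next
    case 4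
    have "hi - lo = (h - l) / 2" using 4 lh by (auto simp: Let_def field_simps split: if_splits)
    with IH(4) show ?case by simp
  next
    case 5 with IH lh show ?case by (auto simp: Let_def split: if_splits)
  next
    case 6 with IH lh show ?case by (auto simp: Let_def split: if_splits)
  }
qed

theorem theorem28:
  fixes P :: "('n::finite, 'u::finite, 'g::finite, 'h::{finite,linorder}) two_phase"
    and tb \<epsilon> :: real
  assumes "standing P"
    and "A_long P tb"
    and "\<epsilon> > 0"
  shows "\<exists>k ts. ts = snd (bisection P tb k) \<and> ts \<in> {0<..<tb} \<and>
           m_star P + ereal (tf P * l_cost P (rho_min P)) < v P ts \<and>
           v P ts < m_star P + ereal (tf P * l_cost P (rho_min P)) + ereal (\<epsilon> / 2) \<and>
           normal P (objective9 P ts) ts"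
proof -
  let ?J = "objective9 P"
  have tf: "0 < tf P" and G: "affine_map (G_term P)" and convg: "convex_on UNIV (g_con P)"
    and contm: "continuous_on UNIV (m_cost P)" and contg: "continuous_on UNIV (g_con P)"
    and contl: "continuous_on UNIV (l_cost P)"
    using assms(1) by (auto simp: standing_def C1_continuous_on)
  have tb: "0 \<le> tb" "threshold P < v P tb"
    and cond: "\<And>t. t \<in> {0..tb} \<Longrightarrow> cond_a P t \<and> cond_b P t \<and> cond_c P t \<and> cond_d P t"
    using assms(2) by (auto simp: A_long_def)
  \<comment> \<open>At \<open>t = tf P\<close> the step is 0 and the integral runs over a single
    point, so \<open>Bd\<close> vanishes. The rank in \<open>cond_b\<close> would then be 0 instead
    of the positive number \<open>CARD('n)\<close>.\<close>
  have tb_tf: "tb < tf P"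
  proof (rule ccontr)
    assume "\<not> tb < tf P"
    then have "cond_b P (tf P)" using cond tf by auto
    moreover have "Bd P (tf P) = 0"
      by (simp add: Bd_def step_def matrix_matrix_mult_def vec_eq_iff)
    then have "mat_pow (Ad P (tf P)) k ** Bd P (tf P) = 0" for k
      by (simp add: matrix_matrix_mult_def vec_eq_iff)
    then have "(\<Union>k<CARD('n). columns (mat_pow (Ad P (tf P)) k ** Bd P (tf P))) \<subseteq> {0}"
      by (auto simp: columns_def column_def vec_eq_iff)
    then have "dim (\<Union>k<CARD('n). columns (mat_pow (Ad P (tf P)) k ** Bd P (tf P))) = 0"
      by (simp only: dim_eq_0)
    ultimately show False by (simp add: cond_b_def)
  qed
  let ?S = "{(t, z). t \<in> {0..tb} \<and> feasible P t z}"
  have "compact ?S"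
    using cond[of 0] tb(1) by (intro compact_feasible_graph G contg tb_tf) (auto simp: cond_a_def)
  have contJ: "continuous_on X (\<lambda>(t, z). ?J t z)" for X
    by (rule continuous_on_objective9[OF contm contl])
  \<comment> \<open>The long-horizon solution of (P4) supplies a minimizer of (P7), so
    \<open>m_star P\<close> and the threshold are finite.\<close>
  obtain x where x: "solves7 P x"
    using assms(2) by (auto simp: A_long_def long_horizon_def)
  have m_star: "m_star P = ereal (m_cost P x)"
    unfolding m_star_def using x
    by (intro antisym INF_lower INF_greatest)
       (auto simp: solves7_def is_arg_min_linorder)
  define \<theta> where "\<theta> = m_cost P x + tf P * l_cost P (rho_min P)"
  have threshold: "threshold P = ereal \<theta>"
    by (simp add: threshold_def m_star \<theta>_def)

  \<comment> \<open>The feasible set at t is a slice of the compact graph and is nonempty by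
    \<open>cond_d\<close>, so the continuous objective attains its minimum.\<close>
  have attained: "\<exists>z. is_arg_min (?J t) (feasible P t) z \<and> v P t = ereal (?J t z)"
    if t: "t \<in> {0..tb}" for t
  proof -
    have "compact ({t} \<times> UNIV \<inter> ?S)"
      using \<open>compact ?S\<close> by (intro closed_Int_compact closed_Times) auto
    then have "compact (snd ` ({t} \<times> UNIV \<inter> ?S))"
      by (intro compact_continuous_image continuous_intros)
    also have "snd ` ({t} \<times> UNIV \<inter> ?S) = {z. feasible P t z}"
      using t by force
    finally have "compact {z. feasible P t z}" .
    moreover obtain z0 where "feasible P t z0"
      using cond[OF t] interior_subset by (fastforce simp: cond_d_def feasible_def)
    moreover have "continuous_on {z. feasible P t z} (?J t)"
      using continuous_on_compose2[OF contJ[of UNIV], of _ "\<lambda>z. (t, z)"]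
      by (auto simp: continuous_on_Pair)
    ultimately obtain z where z: "feasible P t z" "\<And>y. feasible P t y \<Longrightarrow> ?J t z \<le> ?J t y"
      using continuous_attains_inf[of "{z. feasible P t z}" "?J t"] by blast
    then have "v P t = ereal (?J t z)"
      unfolding v_def by (intro antisym INF_lower INF_greatest) auto
    with z show ?thesis by (intro exI[of _ z]) (simp add: is_arg_min_linorder)
  qed

  \<comment> \<open>With every \<sigma> equal to \<open>rho_min P\<close>, the N stages contribute
    \<open>(tf P - t) * l_cost P (rho_min P)\<close> in total. The first phase adds the missing
    multiple t, so the value does not depend on t.\<close>
  have value_rho_min: "?J t z = \<theta>"
    if "\<forall>i. sigma z $ i = rho_min P" "solves7 P (final_state z)" for t z
  proof -
    have "m_cost P (final_state z) = m_cost P x"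
      using x that(2) by (auto simp: solves7_def is_arg_min_linorder intro: antisym)
    with that(1) show ?thesis
      by (simp add: objective9_def stage_cost9_def step_def \<theta>_def)
         (simp add: algebra_simps)
  qed
  \<comment> \<open>(P4) and (P9) at t = 0 share their feasible points but not their objectives.
    Feasibility of \<open>z4\<close> suffices to bound \<open>v P 0\<close> by \<theta>.\<close>
  obtain z4 where "feasible P 0 z4" "\<forall>i. sigma z4 $ i = rho_min P" "solves7 P (final_state z4)"
    using assms(2) by (auto simp: A_long_def long_horizon_def is_arg_min_def)
  then have v0: "v P 0 \<le> threshold P"
    unfolding threshold v_def using value_rho_min by (intro INF_lower2[of z4]) auto
  note inv = bisection_invariant[OF v0 tb(2,1)]

  \<comment> \<open>Each current \<open>t_low\<close> is paired with a minimizer, whose value is at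
    most \<theta> by the invariant. These pairs are points of the compact graph
    \<open>?S\<close>.\<close>
  have "\<exists>p. p \<in> ?S \<and> fst p = fst (bisection P tb k) \<and> ?J (fst p) (snd p) \<le> \<theta>" for k
  proof -
    obtain lo hi where lh: "bisection P tb k = (lo, hi)" by fastforce
    then have lo: "lo \<in> {0..tb}" using inv(1,2,3)[OF lh] by auto
    from attained[OF lo] inv(5)[OF lh] obtain z where "feasible P lo z" "?J lo z \<le> \<theta>"
      by (auto simp: threshold is_arg_min_def)
    with lo lh show ?thesis by (intro exI[of _ "(lo, z)"]) auto
  qed
  then have "\<forall>k. \<exists>p. p \<in> ?S \<and> fst p = fst (bisection P tb k) \<and> ?J (fst p) (snd p) \<le> \<theta>" ..
  from choice[OF this] obtain p where pk:
    "\<forall>k. p k \<in> ?S \<and> fst (p k) = fst (bisection P tb k) \<and> ?J (fst (p k)) (snd (p k)) \<le> \<theta>" ..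
  have p: "p k \<in> ?S" "fst (p k) = fst (bisection P tb k)" "?J (fst (p k)) (snd (p k)) \<le> \<theta>" for k
    by (rule conjunct1[OF spec[OF pk]] conjunct1[OF conjunct2[OF spec[OF pk]]]
        conjunct2[OF conjunct2[OF spec[OF pk]]])+
  obtain q r where q: "q \<in> ?S" and r: "strict_mono r" "(p \<circ> r) \<longlonglongrightarrow> q"
    by (rule seq_compactE[OF compact_imp_seq_compact[OF \<open>compact ?S\<close>] allI[OF p(1)]])
  obtain t0 z1 where tz: "q = (t0, z1)" by (rule prod.exhaust)
  have t0: "t0 \<in> {0..tb}" and z1: "feasible P t0 z1" using q tz by auto
  have "(\<lambda>k. (\<lambda>(t, z). ?J t z) ((p \<circ> r) k)) \<longlonglongrightarrow> (\<lambda>(t, z). ?J t z) q"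
    using contJ[of UNIV] r(2) by (rule continuous_on_tendsto_compose) auto
  then have J1: "?J t0 z1 \<le> \<theta>"
    using p(3) by (intro LIMSEQ_le_const2[where X = "\<lambda>k. (\<lambda>(t, z). ?J t z) ((p \<circ> r) k)"])
      (auto simp: tz split_def)
  then have "v P t0 \<le> threshold P"
    unfolding threshold v_def using z1 by (intro INF_lower2[of z1]) auto
  \<comment> \<open>The value exceeds the threshold at \<open>tb\<close> but not at
    \<open>t0\<close>, so the two differ.\<close>
  with tb(2) t0 have "t0 < tb" by (metis atLeastAtMost_iff leD order_le_less)
  obtain L c where L: "linear L" "surj L" "\<forall>z. F_eq P t0 z = L z + c"
    by (rule F_eq_surjective_part[OF G conjunct1[OF conjunct2[OF conjunct2[OF cond[OF t0]]]]])
  obtain z0 where z0: "z0 \<in> interior (V_set P)" "F_eq P t0 z0 = 0"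
    using cond[OF t0] by (auto simp: cond_d_def)
  have "\<exists>d>0. \<forall>t\<in>{0..tb}. dist t t0 < d \<longrightarrow>
      (\<exists>z\<in>V_set P. F_eq P t z = 0 \<and> ?J t z < \<theta> + \<epsilon> / 2)"
  proof (rule slater_perturbation[OF compact_Icc t0 continuous_on_F_eq[OF G tb_tf] contJ L(1,2) spec[OF L(3)]
        convex_V_set[OF convg] z0])
    show "z1 \<in> V_set P" "F_eq P t0 z1 = 0" using z1 by (simp_all add: feasible_def)
    show "?J t0 z1 < \<theta> + \<epsilon> / 2" using J1 assms(3) by simp
  qed
  then obtain d where d: "d > 0"
    "\<And>t. t \<in> {0..tb} \<Longrightarrow> dist t t0 < d \<Longrightarrow> \<exists>z\<in>V_set P. F_eq P t z = 0 \<and> ?J t z < \<theta> + \<epsilon> / 2"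
    by blast

  \<comment> \<open>The sequence was extracted for \<open>t_low\<close>. Adding the interval length
    \<open>tb / 2 ^ r k\<close>, which tends to 0, turns it into the sequence of
    \<open>t_high\<close>.\<close>
  have "(\<lambda>k. fst ((p \<circ> r) k)) \<longlonglongrightarrow> t0"
    using tendsto_fst[OF r(2)] by (simp add: tz)
  moreover have "(\<lambda>k. tb * (1 / 2) ^ r k) \<longlonglongrightarrow> tb * 0"
    using LIMSEQ_subseq_LIMSEQ[OF LIMSEQ_power_zero[of "1/2 :: real"] r(1)]
    by (intro tendsto_mult tendsto_const) (auto simp: o_def)
  ultimately have "(\<lambda>k. fst ((p \<circ> r) k) + tb * (1 / 2) ^ r k) \<longlonglongrightarrow> t0 + tb * 0"
    by (rule tendsto_add)
  moreover have "fst ((p \<circ> r) k) + tb * (1 / 2) ^ r k = snd (bisection P tb (r k))" for k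
  proof -
    obtain lo hi where lh: "bisection P tb (r k) = (lo, hi)" by fastforce
    from inv(4)[OF this] show ?thesis using lh by (simp add: p(2) power_one_over field_simps)
  qed
  ultimately have "(\<lambda>k. snd (bisection P tb (r k))) \<longlonglongrightarrow> t0" by simp
  \<comment> \<open>The bound \<open>d\<close> makes the perturbation result applicable, and
    \<open>tb - t0\<close> keeps \<open>t_high\<close> strictly below \<open>tb\<close>.\<close>
  then have "eventually (\<lambda>k. dist (snd (bisection P tb (r k))) t0 < min d (tb - t0)) sequentially"
    using d(1) \<open>t0 < tb\<close> by (intro tendstoD) auto
  then obtain k where k: "dist (snd (bisection P tb (r k))) t0 < min d (tb - t0)"
    using eventually_happens'[OF sequentially_bot] by blast
  obtain lo ts where lh: "bisection P tb (r k) = (lo, ts)" by fastforce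
  have ts: "ts \<in> {0..tb}" using inv(1,2,3)[OF lh] by auto
  have above: "threshold P < v P ts" by (rule inv(6)[OF lh])
  have "ts < tb" using k lh by (simp add: dist_real_def abs_less_iff)
  moreover have "ts \<noteq> 0" using above v0 by auto
  ultimately have inside: "ts \<in> {0<..<tb}" using ts by auto
  obtain z where "feasible P ts z" "?J ts z < \<theta> + \<epsilon> / 2"
    using d(2)[OF ts] k lh by (auto simp: feasible_def)
  then have below: "v P ts < ereal (\<theta> + \<epsilon> / 2)"
    unfolding v_def INF_less_iff by (intro bexI[of _ z]) auto
  have "\<not> long_horizon P (?J ts) ts"
  proof
    assume "long_horizon P (?J ts) ts"
    then obtain z where "feasible P ts z" "?J ts z = \<theta>"
      using value_rho_min by (auto simp: long_horizon_def is_arg_min_def)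
    then have "v P ts \<le> threshold P"
      unfolding threshold v_def by (intro INF_lower2[of z]) auto
    with above show False by simp
  qed
  then have "normal P (?J ts) ts"
    using attained[OF ts] by (auto simp: normal_def)
  with lh inside above below show ?thesis
    by (intro exI[of _ "r k"] exI[of _ ts]) (simp add: threshold_def m_star \<theta>_def)
qed

end
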